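(* Let $K\ge 1$ and $r\ge 0$ be integers. Then $$\frac{r!}{\prod_{i=1}^K (i-1)!} \sum_{(\delta_1,\ldots,\delta_K)} \frac{\prod_{1\le i<j\le K}(\delta_j - \delta_i + j - i)^2}{\prod_{i=1}^K (\delta_i + i - 1)!} = K^r,$$ where the sum is over all tuples of integers $0\le\delta_1\le\delta_2\le\cdots\le\delta_K$ with $\sum_{i=1}^K\delta_i = r$.
   Context: Empty products are equal to $1$. *)

theory Defs
  imports Complex_Main "HOL-Library.FuncSet"
begin

(* A K-tuple is an extensional function on the index set {1..K}, so that distinct
   functions in the set are distinct tuples; the constraint 0 <= delta_1 is the type nat. *)
definition weak_tuples :: "nat \<Rightarrow> nat \<Rightarrow> (nat \<Rightarrow> nat) set" where
  "weak_tuples K r =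
     {\<delta> \<in> {1..K} \<rightarrow>\<^sub>E UNIV. mono_on {1..K} \<delta> \<and> (\<Sum>i=1..K. \<delta> i) = r}"

lemma finite_weak_tuples: "finite (weak_tuples K r)"
proof (rule finite_subset)
  show "weak_tuples K r \<subseteq> {1..K} \<rightarrow>\<^sub>E {..r}"
    unfolding weak_tuples_def
    by (auto simp: PiE_iff extensional_def intro!: member_le_sum)
qed (simp add: finite_PiE)

end

theory Submission
  imports Defs
begin

text \<open>Put \<open>x\<^sub>i = \<delta>\<^sub>i + i\<close> and let \<open>V\<close> be the Vandermonde product. Partial fractions give
  \<open>\<Sum>\<^sub>i V (x + e\<^sub>i) = K V x\<close> and \<open>\<Sum>\<^sub>i (x\<^sub>i - 1) V (x - e\<^sub>i) = r V x\<close> whenever \<open>\<delta>\<close> has sum \<open>r\<close>.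
  Let \<open>S r\<close> be the sum in the theorem. Expanding one factor \<open>V x\<close> of \<open>r S r\<close> by the second identity
  and one factor of \<open>K S (r - 1)\<close> by the first gives two sums over pairs of tuples differing by
  a unit step; a step that leaves the monotone tuples makes two of the shifted \<open>x\<^sub>i\<close> collide
  (or has coefficient \<open>x\<^sub>1 - 1 = 0\<close>), so the sums agree and \<open>r S r = K S (r - 1)\<close>.\<close>

section \<open>Partial fractions at distinct nodes\<close>

text \<open>For distinct nodes this is the factor by which the Vandermonde product changes when
  \<open>x i\<close> moves by \<open>t\<close>. Multiplied by \<open>t\<close>, it is also the
  residue at \<open>y = x i\<close> of the product of all \<open>1 + t / (y - x j)\<close>.\<close>

definition shift_ratio :: "real \<Rightarrow> (nat \<Rightarrow> real) \<Rightarrow> nat set \<Rightarrow> nat \<Rightarrow> real" where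
  "shift_ratio t x I i = (\<Prod>j\<in>I - {i}. 1 + t / (x i - x j))"

lemma shift_ratio_insert_old:
  assumes "finite I" "k \<notin> I" "i \<in> I"
  shows "shift_ratio t x (insert k I) i = (1 + t / (x i - x k)) * shift_ratio t x I i"
proof -
  have "insert k I - {i} = insert k (I - {i})" using assms by auto
  then show ?thesis using assms by (simp add: shift_ratio_def)
qed

lemma shift_ratio_insert_new:
  assumes "k \<notin> I"
  shows "shift_ratio t x (insert k I) k = (\<Prod>j\<in>I. 1 + t / (x k - x j))"
proof -
  have "insert k I - {k} = I" using assms by auto
  then show ?thesis by (simp add: shift_ratio_def)
qed

text \<open>The left side is a rational function of \<open>y\<close> with simple poles at the nodes
  and value 1 at infinity, so it equals 1 plus its principal parts.\<close>

lemma partial_fractions_shift: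
  assumes "finite I" "inj_on x I" "y \<notin> x ` I"
  shows "(\<Prod>j\<in>I. 1 + t / (y - x j)) = 1 + (\<Sum>i\<in>I. t * shift_ratio t x I i / (y - x i))"
  using assms
\<comment> \<open>The point \<open>y\<close> stays arbitrary because the induction hypothesis is
  needed both at \<open>y\<close> and at the new node \<open>x k\<close>.\<close>
proof (induction I arbitrary: y rule: finite_induct)
  case empty
  then show ?case by simp
next
  case (insert k I)
  let ?P = "shift_ratio t x I"
  have inj: "inj_on x I" and xk: "x k \<notin> x ` I" and y: "y \<notin> x ` I" "y \<noteq> x k"
    using insert.prems insert.hyps by auto
  have new: "shift_ratio t x (insert k I) k = 1 + (\<Sum>i\<in>I. t * ?P i / (x k - x i))"
    using insert.IH[OF inj xk] insert.hyps(2) by (simp add: shift_ratio_insert_new)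
  \<comment> \<open>This splits \<open>1 / ((y - x k) * (y - x i))\<close> into simple fractions;
    the terms with pole \<open>x k\<close> add up to the sum in \<open>new\<close>.\<close>
  have "(1 + t / (y - x k)) * (t * ?P i / (y - x i))
      = t * shift_ratio t x (insert k I) i / (y - x i) + t / (y - x k) * (t * ?P i / (x k - x i))"
    if "i \<in> I" for i
  proof -
    have "x i \<noteq> x k" "y \<noteq> x i" using imageI[OF that, of x] xk y by metis+
    then show ?thesis
      using y by (simp add: shift_ratio_insert_old[OF insert.hyps that] divide_simps)
        (simp add: algebra_simps)
  qed
  then have "(1 + t / (y - x k)) * (\<Sum>i\<in>I. t * ?P i / (y - x i))
      = (\<Sum>i\<in>I. t * shift_ratio t x (insert k I) i / (y - x i))
        + t / (y - x k) * (\<Sum>i\<in>I. t * ?P i / (x k - x i))"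
    by (simp add: sum_distrib_left sum.distrib)
  then show ?case
    using insert.IH[OF inj y(1)] insert.hyps new by (simp add: algebra_simps add_divide_distrib)
qed

text \<open>For nonzero \<open>t\<close> this compares the coefficients of \<open>1/y\<close> at
  infinity in \<open>partial_fractions_shift\<close>. In the induction, a new node
  \<open>x k\<close> lowers the old terms by exactly the sum that its own term has in excess of 1,
  so the total grows by 1.\<close>

lemma sum_shift_ratio:
  assumes "finite I" "inj_on x I"
  shows "(\<Sum>i\<in>I. shift_ratio t x I i) = real (card I)"
  using assms
proof (induction I rule: finite_induct)
  case empty
  then show ?case by simp
next
  case (insert k I)
  let ?P = "shift_ratio t x I"
  have inj: "inj_on x I" and xk: "x k \<notin> x ` I"
    using insert.prems insert.hyps by auto
  have "shift_ratio t x (insert k I) i = ?P i - t * ?P i / (x k - x i)" if "i \<in> I" for i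
  proof -
    have "x i \<noteq> x k" using imageI[OF that, of x] xk by metis
    then show ?thesis
      by (simp add: shift_ratio_insert_old[OF insert.hyps that] divide_simps)
        (simp add: algebra_simps)
  qed
  then show ?case
    using insert.IH[OF inj] insert.hyps partial_fractions_shift[OF insert.hyps(1) inj xk, of t]
    by (simp add: shift_ratio_insert_new sum_subtractf)
qed

text \<open>This is the comparison at order \<open>1/y^2\<close>. In the induction, the corrections
  proportional to \<open>x k\<close> cancel, and a new node contributes \<open>x k\<close> plus
  \<open>t\<close> times the previous \<open>sum_shift_ratio\<close>; these multiples of
  \<open>t\<close> accumulate to a triangular number.\<close>

lemma sum_weighted_shift_ratio:
  assumes "finite I" "inj_on x I"
  shows "(\<Sum>i\<in>I. x i * shift_ratio t x I i) = sum x I + t * (card I * (real (card I) - 1) / 2)"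
  using assms
proof (induction I rule: finite_induct)
  case empty
  then show ?case by simp
next
  case (insert k I)
  let ?P = "shift_ratio t x I"
  have inj: "inj_on x I" and xk: "x k \<notin> x ` I"
    using insert.prems insert.hyps by auto
  have "x i * shift_ratio t x (insert k I) i
      = x i * ?P i + t * ?P i - x k * (t * ?P i / (x k - x i))" if "i \<in> I" for i
  proof -
    have "x i \<noteq> x k" using imageI[OF that, of x] xk by metis
    then show ?thesis
      by (simp add: shift_ratio_insert_old[OF insert.hyps that] divide_simps)
        (simp add: algebra_simps)
  qed
  then have "(\<Sum>i\<in>I. x i * shift_ratio t x (insert k I) i)
      = (\<Sum>i\<in>I. x i * ?P i) + t * (\<Sum>i\<in>I. ?P i) - x k * (\<Sum>i\<in>I. t * ?P i / (x k - x i))"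
    by (simp add: sum_subtractf sum.distrib sum_distrib_left)
  then show ?case
    using insert.IH[OF inj] insert.hyps partial_fractions_shift[OF insert.hyps(1) inj xk, of t]
      sum_shift_ratio[OF insert.hyps(1) inj, of t]
    by (simp add: shift_ratio_insert_new field_simps)
qed

section \<open>The Vandermonde product under a shift of one variable\<close>

definition index_pairs :: "nat \<Rightarrow> (nat \<times> nat) set" where
  "index_pairs K = {(i, j). 1 \<le> i \<and> i < j \<and> j \<le> K}"

definition vandermonde :: "nat \<Rightarrow> (nat \<Rightarrow> real) \<Rightarrow> real" where
  "vandermonde K x = (\<Prod>(i, j)\<in>index_pairs K. x j - x i)"

lemma finite_index_pairs [simp]: "finite (index_pairs K)"
  by (rule finite_subset[of _ "{1..K} \<times> {1..K}"]) (auto simp: index_pairs_def)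

lemma vandermonde_eq_0:
  assumes "i \<in> {1..K}" "j \<in> {1..K}" "i < j" "x i = x j"
  shows "vandermonde K x = 0"
  unfolding vandermonde_def using assms
  by (intro prod_zero finite_index_pairs bexI[of _ "(i, j)"]) (auto simp: index_pairs_def)

lemma vandermonde_shift:
  assumes "inj_on x {1..K}" "k \<in> {1..K}"
  shows "vandermonde K (x(k := x k + t)) = vandermonde K x * shift_ratio t x {1..K} k"
proof -
  let ?y = "x(k := x k + t)"
  let ?f = "\<lambda>(i, j). (?y j - ?y i) / (x j - x i)"
  \<comment> \<open>Sends \<open>j\<close> to the ordered pair formed by \<open>j\<close> and
    \<open>k\<close>. Only such pairs have a factor that changes, and the quotient is the same
    whether \<open>k\<close> is the smaller or the larger index.\<close>
  let ?h = "\<lambda>j. (min j k, max j k)"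
  have "shift_ratio t x {1..K} k = (\<Prod>j\<in>{1..K} - {k}. ?f (?h j))"
    unfolding shift_ratio_def
  proof (rule prod.cong)
    fix j assume j: "j \<in> {1..K} - {k}"
    then have "x j \<noteq> x k" using assms by (auto dest: inj_onD)
    then show "1 + t / (x k - x j) = ?f (?h j)"
      using j by (cases "j < k") (auto simp: min_def max_def field_simps)
  qed simp
  also have "\<dots> = prod ?f (?h ` ({1..K} - {k}))"
    by (subst prod.reindex) (auto simp: inj_on_def min_def max_def split: if_splits)
  also have "\<dots> = prod ?f (index_pairs K)"
  proof (rule prod.mono_neutral_left)
    show "?h ` ({1..K} - {k}) \<subseteq> index_pairs K"
      using assms by (auto simp: index_pairs_def)
    show "\<forall>p\<in>index_pairs K - ?h ` ({1..K} - {k}). ?f p = 1"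
    proof
      fix p assume p: "p \<in> index_pairs K - ?h ` ({1..K} - {k})"
      obtain i j where [simp]: "p = (i, j)" by (cases p)
      have ij: "1 \<le> i" "i < j" "j \<le> K" using p by (auto simp: index_pairs_def)
      have "i \<noteq> k"
      proof
        assume "i = k"
        then have "p = ?h j" "j \<in> {1..K} - {k}" using ij by auto
        then show False using p by blast
      qed
      moreover have "j \<noteq> k"
      proof
        assume "j = k"
        then have "p = ?h i" "i \<in> {1..K} - {k}" using ij by auto
        then show False using p by blast
      qed
      moreover have "x i \<noteq> x j" using assms(1) ij by (auto dest: inj_onD)
      ultimately show "?f p = 1" by simp
    qed
  qed simp
  finally have "vandermonde K x * shift_ratio t x {1..K} k
      = (\<Prod>p\<in>index_pairs K. (case p of (i, j) \<Rightarrow> x j - x i) * ?f p)"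
    by (simp add: vandermonde_def prod.distrib)
  also have "\<dots> = vandermonde K ?y"
    unfolding vandermonde_def
  proof (rule prod.cong)
    fix p assume p: "p \<in> index_pairs K"
    obtain i j where [simp]: "p = (i, j)" by (cases p)
    have "x i \<noteq> x j" using assms(1) p by (auto simp: index_pairs_def dest: inj_onD)
    then show "(case p of (i, j) \<Rightarrow> x j - x i) * ?f p = (case p of (i, j) \<Rightarrow> ?y j - ?y i)"
      by simp
  qed simp
  finally show ?thesis by simp
qed

section \<open>Shift identities at the points of a monotone tuple\<close>

text \<open>Adding the index makes a weakly increasing tuple strictly increasing, hence injective.
  Real values keep differences and downward shifts free of truncation.\<close>

definition staircase :: "(nat \<Rightarrow> nat) \<Rightarrow> nat \<Rightarrow> real" where
  "staircase \<delta> i = real (\<delta> i) + real i"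

lemma staircase_inj:
  assumes "mono_on {1..K} \<delta>"
  shows "inj_on (staircase \<delta>) {1..K}"
proof (rule linorder_inj_onI')
  fix i j assume "i \<in> {1..K}" "j \<in> {1..K}" "i < j"
  then show "staircase \<delta> i \<noteq> staircase \<delta> j"
    using mono_onD[OF assms, of i j] by (auto simp: staircase_def)
qed

lemma sum_staircase:
  assumes "\<delta> \<in> weak_tuples K r"
  shows "sum (staircase \<delta>) {1..K} = real r + K * (K + 1) / 2"
proof -
  have "(\<Sum>i=1..K. real i) = K * (K + 1) / 2"
    by (induction K) (auto simp: field_simps)
  moreover have "(\<Sum>i=1..K. real (\<delta> i)) = real r"
    using assms by (auto simp: weak_tuples_def simp flip: of_nat_sum)
  ultimately show ?thesis
    by (simp add: staircase_def sum.distrib distrib_left)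
qed

lemma sum_vandermonde_up:
  assumes "\<delta> \<in> weak_tuples K r"
  shows "(\<Sum>i=1..K. vandermonde K ((staircase \<delta>)(i := staircase \<delta> i + 1)))
    = K * vandermonde K (staircase \<delta>)"
proof -
  have inj: "inj_on (staircase \<delta>) {1..K}"
    using assms by (intro staircase_inj) (auto simp: weak_tuples_def)
  show ?thesis
    using sum_shift_ratio[OF _ inj, of 1]
    by (simp add: vandermonde_shift[OF inj] flip: sum_distrib_left)
qed

text \<open>With \<open>t = -1\<close> the quotient by the Vandermonde product is the sum of the
  points minus \<open>K * (K - 1) / 2\<close> minus \<open>K\<close>. As the points sum to
  \<open>r + K * (K + 1) / 2\<close>, exactly \<open>r\<close> remains.\<close>

lemma sum_vandermonde_down:
  assumes "\<delta> \<in> weak_tuples K r"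
  shows "(\<Sum>i=1..K. (staircase \<delta> i - 1) * vandermonde K ((staircase \<delta>)(i := staircase \<delta> i - 1)))
    = r * vandermonde K (staircase \<delta>)"
proof -
  let ?x = "staircase \<delta>"
  let ?P = "shift_ratio (-1) ?x {1..K}"
  have inj: "inj_on ?x {1..K}"
    using assms by (intro staircase_inj) (auto simp: weak_tuples_def)
  have "(\<Sum>i=1..K. (?x i - 1) * vandermonde K (?x(i := ?x i - 1)))
      = vandermonde K ?x * ((\<Sum>i=1..K. ?x i * ?P i) - (\<Sum>i=1..K. ?P i))"
    using vandermonde_shift[OF inj, of _ "-1"]
    by (simp add: sum_distrib_left algebra_simps sum_subtractf)
  also have "(\<Sum>i=1..K. ?x i * ?P i) - (\<Sum>i=1..K. ?P i) = r"
    using sum_shift_ratio[OF _ inj, of "-1"] sum_weighted_shift_ratio[OF _ inj, of "-1"]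
      sum_staircase[OF assms]
    by (simp add: field_simps)
  finally show ?thesis by (simp only: mult.commute[of "real r"])
qed

section \<open>Unit steps between monotone tuples\<close>

text \<open>Raising one entry can only break its comparison with later entries, and by monotonicity
  the immediate successor is the critical one.\<close>

lemma mono_on_incr:
  fixes \<delta> :: "nat \<Rightarrow> nat"
  assumes "mono_on {1..K} \<delta>" "k \<in> {1..K}" "k < K \<Longrightarrow> \<delta> k \<noteq> \<delta> (Suc k)"
  shows "mono_on {1..K} (\<delta>(k := \<delta> k + 1))"
proof (rule mono_onI)
  fix i j assume ij: "i \<in> {1..K}" "j \<in> {1..K}" "i \<le> j"
  have "\<delta> k < \<delta> j" if "i = k" "j \<noteq> k"
  proof -
    have "\<delta> k \<le> \<delta> (Suc k)" "\<delta> (Suc k) \<le> \<delta> j"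
      using ij that by (auto intro!: mono_onD[OF assms(1)])
    moreover have "\<delta> k \<noteq> \<delta> (Suc k)" using ij that by (intro assms(3)) auto
    ultimately show ?thesis by simp
  qed
  moreover have "\<delta> i \<le> \<delta> j" using ij by (intro mono_onD[OF assms(1)])
  ultimately show "(\<delta>(k := \<delta> k + 1)) i \<le> (\<delta>(k := \<delta> k + 1)) j" by auto
qed

lemma mono_on_decr:
  fixes \<delta> :: "nat \<Rightarrow> nat"
  assumes "mono_on {1..K} \<delta>" "k \<in> {1..K}" "1 < k \<Longrightarrow> \<delta> (k - 1) \<noteq> \<delta> k"
  shows "mono_on {1..K} (\<delta>(k := \<delta> k - 1))"
proof (rule mono_onI)
  fix i j assume ij: "i \<in> {1..K}" "j \<in> {1..K}" "i \<le> j"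
  have "\<delta> i < \<delta> k" if "j = k" "i \<noteq> k"
  proof -
    have "\<delta> i \<le> \<delta> (k - 1)" "\<delta> (k - 1) \<le> \<delta> k"
      using ij that by (auto intro!: mono_onD[OF assms(1)])
    moreover have "\<delta> (k - 1) \<noteq> \<delta> k" using ij that by (intro assms(3)) auto
    ultimately show ?thesis by simp
  qed
  moreover have "\<delta> i \<le> \<delta> j" using ij by (intro mono_onD[OF assms(1)])
  ultimately show "(\<delta>(k := \<delta> k - 1)) i \<le> (\<delta>(k := \<delta> k - 1)) j" by auto
qed

lemma incr_mem_weak_tuples:
  assumes "\<delta> \<in> weak_tuples K r" "k \<in> {1..K}" "k < K \<Longrightarrow> \<delta> k \<noteq> \<delta> (Suc k)"
  shows "\<delta>(k := \<delta> k + 1) \<in> weak_tuples K (Suc r)"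
proof -
  have "sum (\<delta>(k := \<delta> k + 1)) {1..K} = Suc (sum \<delta> {1..K})"
    using assms(2) by (simp add: sum.remove[of _ k])
  then show ?thesis
    using assms mono_on_incr[of K \<delta> k]
    by (auto simp: weak_tuples_def PiE_iff extensional_def)
qed

lemma decr_mem_weak_tuples:
  assumes "\<delta> \<in> weak_tuples K (Suc r)" "k \<in> {1..K}" "1 < k \<Longrightarrow> \<delta> (k - 1) \<noteq> \<delta> k" "\<delta> k > 0"
  shows "\<delta>(k := \<delta> k - 1) \<in> weak_tuples K r"
proof -
  have "Suc (sum (\<delta>(k := \<delta> k - 1)) {1..K}) = sum \<delta> {1..K}"
    using assms(2,4) by (simp add: sum.remove[of _ k])
  then show ?thesis
    using assms mono_on_decr[of K \<delta> k]
    by (auto simp: weak_tuples_def PiE_iff extensional_def)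
qed

section \<open>The weighted sum and its recursion in \<open>r\<close>\<close>

definition fact_prod :: "nat \<Rightarrow> (nat \<Rightarrow> nat) \<Rightarrow> real" where
  "fact_prod K \<delta> = (\<Prod>i=1..K. fact (\<delta> i + i - 1))"

text \<open>The factor \<open>\<delta> k + k\<close> is the point
  \<open>staircase \<delta> k\<close> before the step, that is, the raised point minus 1. This is
  the coefficient in \<open>sum_vandermonde_down\<close>.\<close>

lemma fact_prod_incr:
  assumes "k \<in> {1..K}"
  shows "fact_prod K (\<delta>(k := \<delta> k + 1)) = (\<delta> k + k) * fact_prod K \<delta>"
proof -
  have "(fact (\<delta> k + k) :: real) = (\<delta> k + k) * fact (\<delta> k + k - 1)"
    using assms by (subst fact_reduce) auto
  then show ?thesis
    using assms by (simp add: fact_prod_def prod.remove[of _ k])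
qed

definition weighted_sum :: "nat \<Rightarrow> nat \<Rightarrow> real" where
  "weighted_sum K r
    = (\<Sum>\<delta>\<in>weak_tuples K r. (vandermonde K (staircase \<delta>))\<^sup>2 / fact_prod K \<delta>)"

lemma weighted_sum_Suc: "Suc r * weighted_sum K (Suc r) = K * weighted_sum K r"
proof -
  let ?V = "vandermonde K"
  let ?x = staircase
  \<comment> \<open>The pair of a tuple and an index encodes a unit step. One Vandermonde factor
    stays at the tuple, the other is taken at the shifted points; the shifted function need not come
    from a monotone tuple.\<close>
  define up where "up = (\<lambda>(\<delta>, i). ?V (?x \<delta>) * ?V ((?x \<delta>)(i := ?x \<delta> i + 1)) / fact_prod K \<delta>)"
  define down where "down = (\<lambda>(\<delta>, i).
    ?V (?x \<delta>) * ((?x \<delta> i - 1) * ?V ((?x \<delta>)(i := ?x \<delta> i - 1))) / fact_prod K \<delta>)"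
  define A where "A = weak_tuples K (Suc r) \<times> {1..K}"
  define B where "B = weak_tuples K r \<times> {1..K}"
  define badA where "badA = {(\<delta>, i) \<in> A. (1 < i \<and> \<delta> (i - 1) = \<delta> i) \<or> \<delta> i = 0}"
  define badB where "badB = {(\<delta>, i) \<in> B. i < K \<and> \<delta> i = \<delta> (Suc i)}"
  have fin: "finite A" "finite B"
    by (auto simp: A_def B_def finite_weak_tuples)
  have "Suc r * weighted_sum K (Suc r)
      = (\<Sum>\<delta>\<in>weak_tuples K (Suc r). \<Sum>i=1..K. down (\<delta>, i))"
    unfolding weighted_sum_def sum_distrib_left
  proof (rule sum.cong)
    fix \<delta> assume \<delta>: "\<delta> \<in> weak_tuples K (Suc r)"
    show "real (Suc r) * ((?V (?x \<delta>))\<^sup>2 / fact_prod K \<delta>) = (\<Sum>i=1..K. down (\<delta>, i))"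
      unfolding down_def prod.case sum_divide_distrib[symmetric]
        sum_distrib_left[symmetric] sum_vandermonde_down[OF \<delta>]
      by (simp add: power2_eq_square)
  qed simp
  also have "\<dots> = sum down A"
    by (simp add: A_def sum.cartesian_product)
  also have "\<dots> = sum down (A - badA)"
  proof (rule sum.mono_neutral_right)
    have "down p = 0" if "p \<in> badA" for p
    proof -
      from that obtain \<delta> k where p: "p = (\<delta>, k)"
        and d: "\<delta> \<in> weak_tuples K (Suc r)" "k \<in> {1..K}"
        "(1 < k \<and> \<delta> (k - 1) = \<delta> k) \<or> \<delta> k = 0"
        by (auto simp: A_def badA_def)
      show "down p = 0"
      proof (cases "k = 1")
        case True
        \<comment> \<open>For \<open>k = 1\<close> badness means \<open>\<delta> 1 = 0\<close>, so
          the coefficient \<open>staircase \<delta> 1 - 1\<close> vanishes.\<close>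
        then show ?thesis using d(3) by (simp add: p down_def staircase_def)
      next
        case False
        \<comment> \<open>For \<open>k > 1\<close> a zero entry forces a zero predecessor, so both
          kinds of badness give equal neighbours. Lowering the point at \<open>k\<close> then makes
          it coincide with the one at \<open>k - 1\<close>.\<close>
        then have "\<delta> (k - 1) \<le> \<delta> k"
          using d(1,2) by (auto simp: weak_tuples_def intro!: mono_onD[of "{1..K}" \<delta>])
        then have "\<delta> (k - 1) = \<delta> k" using d(3) by auto
        then have "?V ((?x \<delta>)(k := ?x \<delta> k - 1)) = 0"
          using False d(2) by (intro vandermonde_eq_0[of "k - 1" _ k]) (auto simp: staircase_def)
        then show ?thesis by (simp add: p down_def)
      qed
    qed
    then show "\<forall>p\<in>A - (A - badA). down p = 0" by blast
  qed (auto simp: fin)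
  \<comment> \<open>Each good step down from a tuple of sum \<open>Suc r\<close> is the reverse of a
    good step up from a tuple of sum \<open>r\<close>, with the same index.\<close>
  also have "\<dots> = sum up (B - badB)"
  proof (rule sum.reindex_bij_witness[
        where i = "\<lambda>(\<delta>, i). (\<delta>(i := \<delta> i + 1), i)" and j = "\<lambda>(\<delta>, i). (\<delta>(i := \<delta> i - 1), i)"])
    fix p assume "p \<in> A - badA"
    moreover obtain \<delta> k where p: "p = (\<delta>, k)" by (cases p)
    ultimately have d: "\<delta> \<in> weak_tuples K (Suc r)" "k \<in> {1..K}"
      "1 < k \<Longrightarrow> \<delta> (k - 1) \<noteq> \<delta> k" "\<delta> k > 0"
      by (auto simp: A_def badA_def)
    let ?\<epsilon> = "\<delta>(k := \<delta> k - 1)"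
    have \<delta>: "?\<epsilon>(k := ?\<epsilon> k + 1) = \<delta>" using d(4) by auto
    show "(\<lambda>(\<delta>, i). (\<delta>(i := \<delta> i + 1), i)) ((\<lambda>(\<delta>, i). (\<delta>(i := \<delta> i - 1), i)) p) = p"
      using \<delta> by (simp add: p)
    \<comment> \<open>After the decrement this inequality becomes strict, so the pair is not in
      \<open>badB\<close>.\<close>
    have "\<delta> k \<le> \<delta> (Suc k)" if "k < K"
      using d(1,2) that by (auto simp: weak_tuples_def intro: mono_onD)
    then show "(\<lambda>(\<delta>, i). (\<delta>(i := \<delta> i - 1), i)) p \<in> B - badB"
      using decr_mem_weak_tuples[OF d] d(2,4) by (fastforce simp: p B_def badB_def)
    \<comment> \<open>The two Vandermonde factors swap roles under the step, and the coefficient in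
      \<open>down\<close> cancels against the ratio of the factorial products.\<close>
    have x: "?x ?\<epsilon> = (?x \<delta>)(k := ?x \<delta> k - 1)" "(?x ?\<epsilon>)(k := ?x ?\<epsilon> k + 1) = ?x \<delta>"
      using d(4) by (auto simp: staircase_def)
    have "fact_prod K \<delta> = (?x \<delta> k - 1) * fact_prod K ?\<epsilon>"
      using fact_prod_incr[OF d(2), of ?\<epsilon>] d(4) unfolding \<delta> by (simp add: staircase_def)
    moreover have "?x \<delta> k - 1 \<noteq> 0"
      using d(2,4) by (simp add: staircase_def)
    ultimately show "up ((\<lambda>(\<delta>, i). (\<delta>(i := \<delta> i - 1), i)) p) = down p"
      unfolding p up_def down_def prod.case x(2) by (simp add: x(1) del: One_nat_def)
  next
    fix p assume "p \<in> B - badB"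
    moreover obtain \<delta> k where p: "p = (\<delta>, k)" by (cases p)
    ultimately have d: "\<delta> \<in> weak_tuples K r" "k \<in> {1..K}"
      "k < K \<Longrightarrow> \<delta> k \<noteq> \<delta> (Suc k)"
      by (auto simp: B_def badB_def)
    show "(\<lambda>(\<delta>, i). (\<delta>(i := \<delta> i - 1), i)) ((\<lambda>(\<delta>, i). (\<delta>(i := \<delta> i + 1), i)) p) = p"
      by (simp add: p)
    have "\<delta> (k - 1) \<le> \<delta> k" if "1 < k"
      using d(1,2) that by (auto simp: weak_tuples_def intro!: mono_onD[of "{1..K}" \<delta>])
    then show "(\<lambda>(\<delta>, i). (\<delta>(i := \<delta> i + 1), i)) p \<in> A - badA"
      using incr_mem_weak_tuples[OF d] d(2) by (auto simp: p A_def badA_def split: if_splits)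
  qed
  also have "\<dots> = sum up B"
  proof (rule sum.mono_neutral_left)
    have "up p = 0" if "p \<in> badB" for p
    proof -
      from that obtain \<delta> k where p: "p = (\<delta>, k)"
        and d: "k \<in> {1..K}" "k < K" "\<delta> k = \<delta> (Suc k)"
        by (auto simp: B_def badB_def)
      have "?V ((?x \<delta>)(k := ?x \<delta> k + 1)) = 0"
        using d by (intro vandermonde_eq_0[of k _ "Suc k"]) (auto simp: staircase_def)
      then show "up p = 0" by (simp add: p up_def)
    qed
    then show "\<forall>p\<in>B - (B - badB). up p = 0" by blast
  qed (auto simp: fin)
  also have "\<dots> = (\<Sum>\<delta>\<in>weak_tuples K r. \<Sum>i=1..K. up (\<delta>, i))"
    by (simp add: B_def sum.cartesian_product)
  also have "\<dots> = K * weighted_sum K r"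
    unfolding weighted_sum_def sum_distrib_left
  proof (rule sum.cong)
    fix \<delta> assume \<delta>: "\<delta> \<in> weak_tuples K r"
    show "(\<Sum>i=1..K. up (\<delta>, i)) = real K * ((?V (?x \<delta>))\<^sup>2 / fact_prod K \<delta>)"
      unfolding up_def prod.case sum_divide_distrib[symmetric]
        sum_distrib_left[symmetric] sum_vandermonde_up[OF \<delta>]
      by (simp add: power2_eq_square)
  qed simp
  finally show ?thesis .
qed

section \<open>The value at \<open>r = 0\<close> and the solution of the recursion\<close>

text \<open>Grouping the pairs by the larger index \<open>j\<close>, the differences run through 1
  up to \<open>j - 1\<close>.\<close>

lemma prod_index_pairs_diff:
  "(\<Prod>(i, j)\<in>index_pairs K. real j - real i) = (\<Prod>i=1..K. fact (i - 1))"
proof -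
  have inner: "(\<Prod>i\<in>{1..<j}. real j - real i) = fact (j - 1)" for j
  proof -
    have "(\<Prod>i\<in>{1..<j}. real j - real i) = (\<Prod>m\<in>{1..j - 1}. real m)"
      by (rule prod.reindex_bij_witness[of _ "\<lambda>m. j - m" "\<lambda>i. j - i"]) auto
    \<comment> \<open>Here \<open>fact_prod\<close> is the library's product formula for the
      factorial, not the constant of that name.\<close>
    then show ?thesis by (simp add: fact_prod)
  qed
  have "(\<Prod>(i, j)\<in>index_pairs K. real j - real i)
      = (\<Prod>(j, i)\<in>(SIGMA j:{1..K}. {1..<j}). real j - real i)"
    by (rule prod.reindex_bij_witness[of _ prod.swap prod.swap]) (auto simp: index_pairs_def)
  also have "\<dots> = (\<Prod>j=1..K. fact (j - 1))"
    by (subst prod.Sigma[symmetric]) (auto simp only: inner)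
  finally show ?thesis .
qed

text \<open>Only the zero tuple has sum 0. Its Vandermonde product equals its factorial product, so
  the square over the latter leaves one copy.\<close>

lemma weighted_sum_0: "weighted_sum K 0 = (\<Prod>i=1..K. fact (i - 1))"
proof -
  have W: "weak_tuples K 0 = {\<lambda>i\<in>{1..K}. 0}"
    by (auto simp: weak_tuples_def PiE_iff extensional_def restrict_def mono_on_def)
  have "vandermonde K (staircase (\<lambda>i\<in>{1..K}. 0))
      = (\<Prod>(i, j)\<in>index_pairs K. real j - real i)"
    unfolding vandermonde_def
    by (rule prod.cong) (auto simp: index_pairs_def staircase_def)
  moreover have "fact_prod K (\<lambda>i\<in>{1..K}. 0) = (\<Prod>i=1..K. fact (i - 1))"
    unfolding fact_prod_def by (rule prod.cong) auto
  ultimately show ?thesis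
    by (simp add: weighted_sum_def W prod_index_pairs_diff power2_eq_square)
qed

lemma fact_weighted_sum:
  "fact r * weighted_sum K r = K ^ r * (\<Prod>i=1..K. fact (i - 1))"
proof (induction r)
  case 0
  then show ?case by (simp add: weighted_sum_0)
next
  case (Suc r)
  have "fact (Suc r) * weighted_sum K (Suc r) = fact r * (Suc r * weighted_sum K (Suc r))"
    by (simp add: algebra_simps)
  also have "\<dots> = K * (fact r * weighted_sum K r)"
    by (simp only: weighted_sum_Suc) (simp add: algebra_simps)
  finally show ?case by (simp only: Suc.IH) simp
qed

theorem mainTheorem4:
  fixes K r :: nat
  assumes "K \<ge> 1"
  shows "(fact r :: real) / (\<Prod>i=1..K. fact (i - 1)) *
    (\<Sum>\<delta>\<in>weak_tuples K r.
        (\<Prod>(i, j)\<in>{(i, j). 1 \<le> i \<and> i < j \<and> j \<le> K}.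
            (real (\<delta> j) - real (\<delta> i) + real j - real i)\<^sup>2)
        / (\<Prod>i=1..K. fact (\<delta> i + i - 1)))
    = real K ^ r"
proof -
  have "(\<Prod>(i, j)\<in>{(i, j). 1 \<le> i \<and> i < j \<and> j \<le> K}.
      (real (\<delta> j) - real (\<delta> i) + real j - real i)\<^sup>2) = (vandermonde K (staircase \<delta>))\<^sup>2" for \<delta>
    unfolding vandermonde_def index_pairs_def staircase_def prod_power_distrib
    by (rule prod.cong) (auto simp: algebra_simps)
  then have "(fact r :: real) / (\<Prod>i=1..K. fact (i - 1)) *
    (\<Sum>\<delta>\<in>weak_tuples K r.
        (\<Prod>(i, j)\<in>{(i, j). 1 \<le> i \<and> i < j \<and> j \<le> K}.
            (real (\<delta> j) - real (\<delta> i) + real j - real i)\<^sup>2)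
        / (\<Prod>i=1..K. fact (\<delta> i + i - 1)))
    = fact r * weighted_sum K r / (\<Prod>i=1..K. fact (i - 1))"
    by (simp add: weighted_sum_def fact_prod_def)
  also have "\<dots> = real K ^ r"
    by (simp add: fact_weighted_sum)
  finally show ?thesis .
qed

end
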